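(* Let $p$ be a non-negative integer and let $G$ be a connected $\{\text{butterfly},\text{hammer},(K_1\cup K_2)+K_p\}$-free graph with $\omega(G)\neq 2$. Then $$\chi(G)\leq \begin{cases} \omega(G)+\frac{p(p+1)}{2} & \text{if } 1\leq \omega(G)\leq p+1,\\ \omega(G)+\frac{p(p-1)}{2} & \text{if } \omega(G)\geq p+2.\end{cases}$$
   Context: All graphs are simple, finite and undirected. $\omega(G)$ is the clique number and $\chi(G)$ the chromatic number of $G$. For a family $\mathcal{F}$ of graphs, $G$ is $\mathcal{F}$-free if it has no induced subgraph isomorphic to a member of $\mathcal{F}$. The butterfly is the graph on five vertices consisting of two triangles sharing exactly one vertex (with no other edges). The hammer is the graph on five vertices $a,b,c,d,e$ with edges $ab,bc,ac,cd,de$. $K_n$ is the complete graph on $n$ vertices, $K_1\cup K_2$ is the disjoint union of $K_1$ and $K_2$, and for vertex-disjoint graphs $G_1,G_2$ the join $G_1+G_2$ is obtained from their disjoint union by adding all edges between $V(G_1)$ and $V(G_2)$; for $p=0$, $(K_1\cup K_2)+K_p$ is $K_1\cup K_2$. *)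

theory Defs
  imports "Graph_Theory.Graph_Theory"
begin

text \<open>A finite simple undirected graph is a symmetric loop-free digraph (locale
  \<^locale>\<open>pair_graph\<close>): each undirected edge is present as both of its orientations.\<close>

definition clique :: "('a, 'b) pre_digraph \<Rightarrow> 'a set \<Rightarrow> bool" where
  "clique G S \<longleftrightarrow> S \<subseteq> verts G \<and> (\<forall>u\<in>S. \<forall>v\<in>S. u \<noteq> v \<longrightarrow> u \<rightarrow>\<^bsub>G\<^esub> v)"

text \<open>The empty set is a clique, so the maximum exists for every finite graph;
  it is 0 exactly for the null graph.\<close>

definition clique_number :: "('a, 'b) pre_digraph \<Rightarrow> nat" where
  "clique_number G = Max {card S | S. clique G S}"

definition proper_coloring :: "('a, 'b) pre_digraph \<Rightarrow> nat \<Rightarrow> ('a \<Rightarrow> nat) \<Rightarrow> bool" where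
  "proper_coloring G k c \<longleftrightarrow>
     (\<forall>v\<in>verts G. c v < k) \<and> (\<forall>u v. u \<rightarrow>\<^bsub>G\<^esub> v \<longrightarrow> c u \<noteq> c v)"

definition chromatic_number :: "('a, 'b) pre_digraph \<Rightarrow> nat" where
  "chromatic_number G = (LEAST k. \<exists>c. proper_coloring G k c)"

definition induced_free :: "('c, 'd) pre_digraph \<Rightarrow> ('a, 'b) pre_digraph \<Rightarrow> bool" where
  "induced_free F G \<longleftrightarrow> \<not> (\<exists>H. induced_subgraph H G \<and> digraph_iso H F)"

definition graph_of_edges :: "'a set \<Rightarrow> ('a \<times> 'a) set \<Rightarrow> 'a pair_pre_digraph" where
  "graph_of_edges V E = \<lparr> pverts = V, parcs = E \<union> E\<inverse> \<rparr>"

definition butterfly :: "nat pair_pre_digraph" where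
  "butterfly = graph_of_edges {0, 1, 2, 3, 4} {(0,1), (1,2), (0,2), (0,3), (3,4), (0,4)}"

definition hammer :: "nat pair_pre_digraph" where
  "hammer = graph_of_edges {0, 1, 2, 3, 4} {(0,1), (1,2), (0,2), (2,3), (3,4)}"

definition complete_graph :: "nat \<Rightarrow> nat pair_pre_digraph" where
  "complete_graph n = \<lparr> pverts = {..<n}, parcs = {(i, j). i < n \<and> j < n \<and> i \<noteq> j} \<rparr>"

definition disjoint_union ::
    "'a pair_pre_digraph \<Rightarrow> 'b pair_pre_digraph \<Rightarrow> ('a + 'b) pair_pre_digraph" where
  "disjoint_union G H =
     \<lparr> pverts = pverts G <+> pverts H,
       parcs = map_prod Inl Inl ` parcs G \<union> map_prod Inr Inr ` parcs H \<rparr>"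

definition graph_join ::
    "'a pair_pre_digraph \<Rightarrow> 'b pair_pre_digraph \<Rightarrow> ('a + 'b) pair_pre_digraph" where
  "graph_join G H =
     \<lparr> pverts = pverts G <+> pverts H,
       parcs = parcs (disjoint_union G H)
         \<union> Inl ` pverts G \<times> Inr ` pverts H \<union> Inr ` pverts H \<times> Inl ` pverts G \<rparr>"

lemma pair_graph_butterfly: "pair_graph butterfly"
  by unfold_locales (auto simp: butterfly_def graph_of_edges_def symmetric_def sym_def)

lemma pair_graph_hammer: "pair_graph hammer"
  by unfold_locales (auto simp: hammer_def graph_of_edges_def symmetric_def sym_def)

lemma complete_graph_complete: "complete_digraph n (complete_graph n)"
proof -
  have "parcs (complete_graph n)
      = {(u, v). (u, v) \<in> pverts (complete_graph n) \<times> pverts (complete_graph n) \<and> u \<noteq> v}"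
    by (auto simp: complete_graph_def)
  then show ?thesis by (simp add: complete_digraph_pair_def complete_graph_def)
qed

lemma pair_graph_disjoint_union:
  assumes "pair_graph G" "pair_graph H"
  shows "pair_graph (disjoint_union G H)"
proof -
  interpret G: pair_graph G by fact
  interpret H: pair_graph H by fact
  show ?thesis
    using G.pair_sym_arcs H.pair_sym_arcs
    by unfold_locales
      (auto simp: disjoint_union_def symmetric_def dest: G.wellformed' H.wellformed'
        G.pair_no_loops H.pair_no_loops intro!: symI dest: symD)
qed

lemma pair_graph_join:
  assumes "pair_graph G" "pair_graph H"
  shows "pair_graph (graph_join G H)"
proof -
  interpret G: pair_graph G by fact
  interpret H: pair_graph H by fact
  interpret U: pair_graph "disjoint_union G H" by (intro pair_graph_disjoint_union assms)
  have [simp]: "pverts (disjoint_union G H) = pverts G <+> pverts H"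
    by (simp add: disjoint_union_def)
  show ?thesis
    using U.pair_sym_arcs
    by unfold_locales
      (auto simp: graph_join_def symmetric_def dest: U.arc_fst_in_verts U.arc_snd_in_verts
        U.pair_no_loops intro!: symI dest: symD)
qed

lemma graph_join_complete_graph_0:
  assumes "pair_wf_digraph G"
  shows "digraph_iso G (graph_join G (complete_graph 0))"
proof -
  interpret G: pair_wf_digraph G by fact
  let ?h = "\<lparr> iso_verts = Inl, iso_arcs = map_prod Inl Inl, iso_head = snd, iso_tail = fst \<rparr>"
  have "G.digraph_isomorphism ?h"
    unfolding G.digraph_isomorphism_def using G.wf_digraph_axioms
    by (auto simp: inj_on_def)
  moreover have "with_proj (graph_join G (complete_graph 0)) = app_iso ?h G"
    by (auto simp: app_iso_def with_proj_def graph_join_def disjoint_union_def complete_graph_def)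
  ultimately show ?thesis unfolding digraph_iso_def by blast
qed

end

theory Submission
  imports Defs
begin

text \<open>
  If \<open>\<omega>(G) \<ge> 3\<close>, connectedness makes \<open>G\<close> almost \<open>2K\<^sub>2\<close>-free: the common non-neighbours of the
  ends of an edge lying in a triangle are independent. Fix a maximum clique \<open>A\<close> and classify the
  vertices \<open>x\<close> by the nonempty set of their non-neighbours in \<open>A\<close>. Those missing exactly one
  \<open>a \<in> A\<close> are independent by maximality of \<open>A\<close>, and those missing a given pair of vertices of \<open>A\<close>
  are independent by the above. Wagon's bound \<open>\<omega> + (\<omega> choose 2)\<close> follows. If \<open>\<omega> \<ge> p + 2\<close>, then a
  vertex missing at least two vertices of \<open>A\<close> has fewer than \<open>p\<close> neighbours in \<open>A\<close>; hence it is
  enough to use the pairs inside a \<open>p\<close>-subset \<open>B\<close> of \<open>A\<close>, and the vertices left over can share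
  the colour of a vertex of \<open>A - B\<close>.
\<close>

section \<open>Forbidden graphs given by named vertices\<close>

text \<open>Transporting \<open>F\<close> along \<open>f\<close> gives a copy whose arcs are all the
  arcs of \<open>G\<close> between image vertices, hence an induced subgraph. A forbidden graph can
  thus be refuted by naming the images of its vertices.\<close>

lemma induced_free_embeddingD:
  fixes F :: "'b pair_pre_digraph" and G :: "'a pair_pre_digraph"
  assumes free: "induced_free F G"
    and F: "pair_graph F" and G: "pair_graph G"
    and inj: "inj_on f (pverts F)" and sub: "f ` pverts F \<subseteq> pverts G"
    and arcs: "\<And>u v. u \<in> pverts F \<Longrightarrow> v \<in> pverts F \<Longrightarrow> (f u, f v) \<in> parcs G \<longleftrightarrow> (u, v) \<in> parcs F"
  shows False
proof -
  interpret F: pair_graph F by fact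
  interpret G: pair_graph G by fact
  let ?h = "\<lparr> iso_verts = f, iso_arcs = map_prod f f, iso_head = snd, iso_tail = fst \<rparr>"
  let ?H = "app_iso ?h (with_proj F)"
  have inj2: "inj_on (map_prod f f) (parcs F)"
  proof (rule inj_on_subset[OF map_prod_inj_on[OF inj inj]])
    show "parcs F \<subseteq> pverts F \<times> pverts F"
      by (auto dest: F.wellformed')
  qed
  have hom: "F.digraph_isomorphism ?h"
    unfolding F.digraph_isomorphism_def using inj inj2 F.wf_digraph_axioms by auto
  have wf: "wf_digraph ?H"
    using F.wf_digraphI_app_iso[OF hom] .
  have arcs_H: "map_prod f f ` parcs F = {e \<in> parcs G. fst e \<in> f ` pverts F \<and> snd e \<in> f ` pverts F}"
  proof (intro equalityI subsetI)
    fix e assume "e \<in> map_prod f f ` parcs F"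
    then obtain u v where uv: "(u, v) \<in> parcs F" "e = (f u, f v)"
      by auto
    then show "e \<in> {e \<in> parcs G. fst e \<in> f ` pverts F \<and> snd e \<in> f ` pverts F}"
      using arcs F.wellformed'[OF uv(1)] by simp
  next
    fix e assume "e \<in> {e \<in> parcs G. fst e \<in> f ` pverts F \<and> snd e \<in> f ` pverts F}"
    then obtain u v where uv: "u \<in> pverts F" "v \<in> pverts F" "e = (f u, f v)" "e \<in> parcs G"
      by (cases e) auto
    then have "(u, v) \<in> parcs F"
      using arcs[OF uv(1,2)] by blast
    then show "e \<in> map_prod f f ` parcs F"
      using uv(3) by (intro image_eqI[of _ _ "(u, v)"]) simp_all
  qed
  have "induced_subgraph ?H G"
    unfolding induced_subgraph_def subgraph_def
    using wf G.wf_digraph_axioms sub by (simp add: compatible_def arcs_H)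
  moreover have "digraph_iso F ?H"
    unfolding digraph_iso_def using hom by blast
  then have "digraph_iso ?H F"
    using digraph_iso_swap F.wf_digraph_axioms by blast
  ultimately show False
    using free unfolding induced_free_def by blast
qed

context pair_graph
begin

lemma parcs_sym: "(u, v) \<in> parcs G \<Longrightarrow> (v, u) \<in> parcs G"
  using pair_sym_arcs by (auto simp: symmetric_def dest: symD)

lemma parcs_irrefl: "(u, u) \<notin> parcs G"
  using pair_no_loops by force

text \<open>The triangle is \<open>a\<close>, \<open>b\<close>, \<open>c\<close>, and the tail
  leaves it at \<open>c\<close> through \<open>d\<close> to \<open>e\<close>.\<close>

lemma hammer_freeD:
  assumes free: "induced_free hammer G"
    and e: "(a, b) \<in> parcs G" "(b, c) \<in> parcs G" "(a, c) \<in> parcs G" "(c, d) \<in> parcs G" "(d, e) \<in> parcs G"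
    and n: "(a, d) \<notin> parcs G" "(b, d) \<notin> parcs G" "(a, e) \<notin> parcs G" "(b, e) \<notin> parcs G" "(c, e) \<notin> parcs G"
  shows False
proof (rule induced_free_embeddingD[OF free pair_graph_hammer pair_graph_axioms])
  have e': "(b, a) \<in> parcs G" "(c, b) \<in> parcs G" "(c, a) \<in> parcs G" "(d, c) \<in> parcs G" "(e, d) \<in> parcs G"
    using e parcs_sym by blast+
  have n': "(d, a) \<notin> parcs G" "(d, b) \<notin> parcs G" "(e, a) \<notin> parcs G" "(e, b) \<notin> parcs G" "(e, c) \<notin> parcs G"
    using n parcs_sym by blast+
  \<comment> \<open>Any two of the five are adjacent or told apart by their adjacency to a third, so
    distinctness comes from the pattern itself.\<close>
  have "distinct [a, b, c, d, e]"
    using e e' n n' parcs_irrefl by auto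
  then show "inj_on ((!) [a, b, c, d, e]) (pverts hammer)"
    by (auto simp: inj_on_def hammer_def graph_of_edges_def numeral_eq_Suc)
  show "(!) [a, b, c, d, e] ` pverts hammer \<subseteq> pverts G"
    using e by (auto simp: hammer_def graph_of_edges_def numeral_eq_Suc dest: wellformed')
  show "([a, b, c, d, e] ! u, [a, b, c, d, e] ! v) \<in> parcs G \<longleftrightarrow> (u, v) \<in> parcs hammer"
    if "u \<in> pverts hammer" "v \<in> pverts hammer" for u v
  proof -
    have "u \<in> {0, 1, 2, 3, 4}" "v \<in> {0, 1, 2, 3, 4}"
      using that by (simp_all add: hammer_def graph_of_edges_def)
    then show ?thesis
      by (elim insertE emptyE)
        (simp_all add: hammer_def graph_of_edges_def e e' n n' parcs_irrefl)
  qed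
qed

text \<open>The shared vertex of the two triangles is \<open>a\<close>.\<close>

lemma butterfly_freeD:
  assumes free: "induced_free butterfly G"
    and e: "(a, b) \<in> parcs G" "(b, c) \<in> parcs G" "(a, c) \<in> parcs G"
      "(a, d) \<in> parcs G" "(d, e) \<in> parcs G" "(a, e) \<in> parcs G"
    and n: "(b, d) \<notin> parcs G" "(b, e) \<notin> parcs G" "(c, d) \<notin> parcs G" "(c, e) \<notin> parcs G"
  shows False
proof (rule induced_free_embeddingD[OF free pair_graph_butterfly pair_graph_axioms])
  have e': "(b, a) \<in> parcs G" "(c, b) \<in> parcs G" "(c, a) \<in> parcs G"
      "(d, a) \<in> parcs G" "(e, d) \<in> parcs G" "(e, a) \<in> parcs G"
    using e parcs_sym by blast+
  have n': "(d, b) \<notin> parcs G" "(e, b) \<notin> parcs G" "(d, c) \<notin> parcs G" "(e, c) \<notin> parcs G"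
    using n parcs_sym by blast+
  have "distinct [a, b, c, d, e]"
    using e e' n n' parcs_irrefl by auto
  then show "inj_on ((!) [a, b, c, d, e]) (pverts butterfly)"
    by (auto simp: inj_on_def butterfly_def graph_of_edges_def numeral_eq_Suc)
  show "(!) [a, b, c, d, e] ` pverts butterfly \<subseteq> pverts G"
    using e by (auto simp: butterfly_def graph_of_edges_def numeral_eq_Suc dest: wellformed')
  show "([a, b, c, d, e] ! u, [a, b, c, d, e] ! v) \<in> parcs G \<longleftrightarrow> (u, v) \<in> parcs butterfly"
    if "u \<in> pverts butterfly" "v \<in> pverts butterfly" for u v
  proof -
    have "u \<in> {0, 1, 2, 3, 4}" "v \<in> {0, 1, 2, 3, 4}"
      using that by (simp_all add: butterfly_def graph_of_edges_def)
    then show ?thesis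
      by (elim insertE emptyE)
        (simp_all add: butterfly_def graph_of_edges_def e e' n n' parcs_irrefl)
  qed
qed

text \<open>Here \<open>r\<close> plays \<open>K_1\<close>, the edge \<open>s\<close>,
  \<open>t\<close> plays \<open>K_2\<close>, and the clique \<open>K\<close>, empty for
  \<open>p = 0\<close>, plays \<open>K_p\<close>.\<close>

lemma join_freeD:
  assumes free: "induced_free
      (graph_join (disjoint_union (complete_graph 1) (complete_graph 2)) (complete_graph p)) G"
    and K: "clique G K" "card K = p" "finite K"
    and rst: "r \<in> pverts G" "(s, t) \<in> parcs G" "(r, s) \<notin> parcs G" "(r, t) \<notin> parcs G"
    and adj: "\<And>k. k \<in> K \<Longrightarrow> (r, k) \<in> parcs G \<and> (s, k) \<in> parcs G \<and> (t, k) \<in> parcs G"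
  shows False
proof -
  let ?F = "graph_join (disjoint_union (complete_graph 1) (complete_graph 2)) (complete_graph p)"
  have pair_complete: "pair_graph (complete_graph n)" for n
    by unfold_locales
      (auto simp: complete_graph_def symmetric_def sym_def intro: finite_subset[of _ "{..<n} \<times> {..<n}"])
  obtain h where h: "bij_betw h {..<p} K"
    using ex_bij_betw_nat_finite[OF K(3)] K(2) by (auto simp: atLeast0LessThan)
  have hK: "h i \<in> K" if "i < p" for i
    using h that by (auto dest: bij_betwE)
  have hh: "h i = h j \<longleftrightarrow> i = j" if "i < p" "j < p" for i j
    using h that by (auto simp: bij_betw_def dest: inj_onD)
  have adjK: "(r, h i) \<in> parcs G" "(s, h i) \<in> parcs G" "(t, h i) \<in> parcs G"
      "(h i, r) \<in> parcs G" "(h i, s) \<in> parcs G" "(h i, t) \<in> parcs G" if "i < p" for i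
    using adj[OF hK[OF that]] parcs_sym by blast+
  have KK: "(h i, h j) \<in> parcs G \<longleftrightarrow> i \<noteq> j" if "i < p" "j < p" for i j
    using K(1) hK hh that parcs_irrefl by (auto simp: clique_def)
  have sym: "(t, s) \<in> parcs G" "(s, r) \<notin> parcs G" "(t, r) \<notin> parcs G"
    using rst parcs_sym by blast+
  have dist: "r \<noteq> s" "r \<noteq> t" "s \<noteq> t" "s \<noteq> r" "t \<noteq> r" "t \<noteq> s"
    using rst sym parcs_irrefl by auto
  have distK: "h i \<noteq> r" "h i \<noteq> s" "h i \<noteq> t" "r \<noteq> h i" "s \<noteq> h i" "t \<noteq> h i" if "i < p" for i
    using adjK[OF that] parcs_irrefl by metis+
  define f where "f = case_sum (case_sum (\<lambda>_::nat. r) (\<lambda>i::nat. if i = 0 then s else t)) h"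
  have V: "pverts ?F = {Inl (Inl 0), Inl (Inr 0), Inl (Inr 1)} \<union> Inr ` {..<p}"
    by (auto simp: graph_join_def disjoint_union_def complete_graph_def Plus_def)
  have small: "parcs (complete_graph 1) = {}" "parcs (complete_graph 2) = {(0, 1), (1, 0)}"
      "pverts (complete_graph 1) = {0}" "pverts (complete_graph 2) = {0, 1}"
    by (auto simp: complete_graph_def)
  have E: "(Inl x, Inl y) \<in> parcs ?F \<longleftrightarrow> x = Inr 0 \<and> y = Inr 1 \<or> x = Inr 1 \<and> y = Inr 0"
      "(Inr i, Inr j) \<in> parcs ?F \<longleftrightarrow> i < p \<and> j < p \<and> i \<noteq> j"
      "(Inl x, Inr i) \<in> parcs ?F \<longleftrightarrow> x \<in> {Inl 0, Inr 0, Inr 1} \<and> i < p"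
      "(Inr i, Inl x) \<in> parcs ?F \<longleftrightarrow> x \<in> {Inl 0, Inr 0, Inr 1} \<and> i < p" for x y i j
    unfolding graph_join_def disjoint_union_def pair_pre_digraph.simps small
    by (auto simp: complete_graph_def image_iff)
  show False
  proof (rule induced_free_embeddingD[OF free _ pair_graph_axioms])
    show "pair_graph ?F"
      by (intro pair_graph_join pair_graph_disjoint_union pair_complete)
    show "inj_on f (pverts ?F)"
      unfolding V using dist distK hh by (auto simp: inj_on_def f_def)
    show "f ` pverts ?F \<subseteq> pverts G"
      unfolding V using rst hK K(1) by (auto simp: f_def clique_def dest: wellformed')
    show "(f u, f v) \<in> parcs G \<longleftrightarrow> (u, v) \<in> parcs ?F" if "u \<in> pverts ?F" "v \<in> pverts ?F" for u v
    proof -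
      have V': "w = Inl (Inl 0) \<or> w = Inl (Inr 0) \<or> w = Inl (Inr 1) \<or> (\<exists>i<p. w = Inr i)"
        if "w \<in> pverts ?F" for w
        using that unfolding V by blast
      have f: "f (Inl (Inl 0)) = r" "f (Inl (Inr 0)) = s" "f (Inl (Inr 1)) = t" "f (Inr i) = h i" for i
        by (simp_all add: f_def)
      show ?thesis
        using V'[OF that(1)] V'[OF that(2)]
        by (elim disjE exE conjE; hypsubst;
            simp only: f E rst sym adjK KK parcs_irrefl sum.inject sum.distinct insert_iff empty_iff;
            simp)
    qed
  qed
qed

section \<open>Common non-neighbours of a triangle edge\<close>

text \<open>Having no neighbour in the triangle, together with an adjacent vertex of the same kind,
  is inherited along edges. By connectedness it would reach the triangle itself.\<close>

lemma no_edge_far_from_triangle: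
  assumes con: "connected G" and bf: "induced_free butterfly G" and hf: "induced_free hammer G"
    and T: "(a, b) \<in> parcs G" "(b, c) \<in> parcs G" "(a, c) \<in> parcs G"
    and xy: "(x, y) \<in> parcs G"
    and x: "\<And>t. t \<in> {a, b, c} \<Longrightarrow> (x, t) \<notin> parcs G"
    and y: "\<And>t. t \<in> {a, b, c} \<Longrightarrow> (y, t) \<notin> parcs G"
  shows False
proof -
  define B where "B = {v \<in> pverts G. \<forall>t \<in> {a, b, c}. (v, t) \<notin> parcs G}"
  have closed: "d \<in> B" if de: "(e, d) \<in> parcs G" "e \<in> B" and ef: "(e, f) \<in> parcs G" "f \<in> B" for d e f
  proof (rule ccontr)
    assume "d \<notin> B"
    \<comment> \<open>If \<open>d\<close> sees two triangle vertices, then \<open>d s t\<close> and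
      \<open>d e f\<close> form a butterfly when \<open>d\<close> and \<open>f\<close> are adjacent;
      otherwise \<open>d e f\<close> is the tail of a hammer on \<open>s t d\<close>.\<close>
    have two: False if "(s, t) \<in> parcs G" "s \<in> {a, b, c}" "t \<in> {a, b, c}"
      "(d, s) \<in> parcs G" "(d, t) \<in> parcs G" for s t
    proof (cases "(d, f) \<in> parcs G")
      case True
      show False
        by (rule butterfly_freeD[OF bf, of d s t e f]) (use True that de ef parcs_sym B_def in blast)+
    next
      case False
      show False
        by (rule hammer_freeD[OF hf, of s t d e f]) (use False that de ef parcs_sym B_def in blast)+
    qed
    \<comment> \<open>By \<open>two\<close>, \<open>u\<close> is the only triangle vertex that
      \<open>d\<close> sees, so the triangle with tail \<open>u d e\<close> is a hammer.\<close>
    have one: False if "(s, t) \<in> parcs G" "(t, u) \<in> parcs G" "(s, u) \<in> parcs G"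
      "s \<in> {a, b, c}" "t \<in> {a, b, c}" "u \<in> {a, b, c}" "(d, u) \<in> parcs G" for s t u
    proof -
      have "(d, s) \<notin> parcs G" "(d, t) \<notin> parcs G"
        using two that parcs_sym by blast+
      then show False
        by (intro hammer_freeD[OF hf, of s t u d e]) (use that de parcs_sym B_def in blast)+
    qed
    have "(d, a) \<in> parcs G \<or> (d, b) \<in> parcs G \<or> (d, c) \<in> parcs G"
      using \<open>d \<notin> B\<close> wellformed'[OF de(1)] by (auto simp: B_def)
    then show False
      using one[of b c a] one[of a c b] one[of a b c] T parcs_sym by blast
  qed
  have "strongly_connected G"
    using symmetric_connected_imp_strongly_connected con pair_sym_arcs by blast
  then have "x \<rightarrow>\<^sup>*\<^bsub>G\<^esub> a"
    using wellformed'[OF xy] wellformed'[OF T(1)] by (auto simp: strongly_connected_def)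
  moreover have "x \<in> B" "y \<in> B"
    using x y wellformed'[OF xy] by (auto simp: B_def)
  \<comment> \<open>The neighbour in \<open>B\<close> is carried along because \<open>closed\<close>
    requires one; after each step the vertex just left serves as this neighbour.\<close>
  ultimately have "a \<in> B \<and> (\<exists>w \<in> B. (a, w) \<in> parcs G)"
  proof (induction rule: reachable_induct)
    case base
    then show ?case using xy by blast
  next
    case (step u v)
    then obtain w where uv: "(u, v) \<in> parcs G" and w: "(u, w) \<in> parcs G" "w \<in> B" and u: "u \<in> B"
      by auto
    then have "v \<in> B"
      using closed[OF uv u w] by blast
    then show ?case
      using u parcs_sym[OF uv] by blast
  qed
  then show False
    using T(1) by (auto simp: B_def)
qed

text \<open>For adjacent \<open>x\<close> and \<open>y\<close>, the third vertex \<open>c\<close>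
  sees both (butterfly), exactly one (hammer), or neither, which leaves an edge far from the
  triangle.\<close>

lemma triangle_edge_anti_neighbours:
  assumes con: "connected G" and bf: "induced_free butterfly G" and hf: "induced_free hammer G"
    and T: "(a, b) \<in> parcs G" "(b, c) \<in> parcs G" "(a, c) \<in> parcs G"
    and x: "(x, a) \<notin> parcs G" "(x, b) \<notin> parcs G" and y: "(y, a) \<notin> parcs G" "(y, b) \<notin> parcs G"
  shows "(x, y) \<notin> parcs G"
proof
  assume xy: "(x, y) \<in> parcs G"
  have n: "(a, x) \<notin> parcs G" "(b, x) \<notin> parcs G" "(a, y) \<notin> parcs G" "(b, y) \<notin> parcs G"
    using x y parcs_sym by blast+
  have "\<not> ((c, x) \<in> parcs G \<and> (c, y) \<in> parcs G)"
    using butterfly_freeD[OF bf, of c a b x y] T xy n parcs_sym by blast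
  moreover have "\<not> ((c, x) \<in> parcs G \<and> (c, y) \<notin> parcs G)"
    using hammer_freeD[OF hf, of a b c x y] T xy n by blast
  moreover have "\<not> ((c, y) \<in> parcs G \<and> (c, x) \<notin> parcs G)"
    using hammer_freeD[OF hf, of a b c y x] T xy n parcs_sym by blast
  ultimately have "(x, c) \<notin> parcs G" "(y, c) \<notin> parcs G"
    using parcs_sym by blast+
  then show False
    using no_edge_far_from_triangle[OF con bf hf T xy] x y by blast
qed

section \<open>Maximum cliques and colourings by covers\<close>

lemma clique_finite: "clique G S \<Longrightarrow> finite S"
  using pair_finite_verts by (auto simp: clique_def intro: finite_subset)

lemma finite_clique_cards: "finite {card S | S. clique G S}"
proof (rule finite_subset)
  show "{card S | S. clique G S} \<subseteq> card ` Pow (pverts G)"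
    by (auto simp: clique_def)
qed (simp add: pair_finite_verts)

lemma clique_card_le: "clique G S \<Longrightarrow> card S \<le> clique_number G"
  unfolding clique_number_def using finite_clique_cards by (auto intro!: Max_ge)

lemma obtain_max_clique:
  obtains A where "clique G A" "card A = clique_number G"
proof -
  have "clique G {}"
    by (simp add: clique_def)
  then have "clique_number G \<in> {card S | S. clique G S}"
    unfolding clique_number_def using finite_clique_cards by (intro Max_in) auto
  then show thesis
    using that by auto
qed

text \<open>The sets may overlap: each vertex picks one independent set containing it, and the
  indices are numbered to serve as colours.\<close>

lemma chromatic_number_le_cover:
  assumes I: "finite I" and cover: "pverts G \<subseteq> (\<Union>i\<in>I. S i)"
    and indep: "\<And>i u v. i \<in> I \<Longrightarrow> u \<in> S i \<Longrightarrow> v \<in> S i \<Longrightarrow> (u, v) \<notin> parcs G"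
  shows "chromatic_number G \<le> card I"
proof -
  obtain h where h: "bij_betw h I {0..<card I}"
    using ex_bij_betw_finite_nat[OF I] by blast
  have "\<forall>v \<in> pverts G. \<exists>i. i \<in> I \<and> v \<in> S i"
    using cover by blast
  then obtain g where g: "\<And>v. v \<in> pverts G \<Longrightarrow> g v \<in> I \<and> v \<in> S (g v)"
    by metis
  have "h (g u) \<noteq> h (g v)" if uv: "(u, v) \<in> parcs G" for u v
  proof
    assume "h (g u) = h (g v)"
    then have "g u = g v"
      using h g wellformed'[OF uv] by (auto simp: bij_betw_def dest: inj_onD)
    then show False
      using indep[of "g u" u v] g[of u] g[of v] wellformed'[OF uv] uv by simp
  qed
  then have "proper_coloring G (card I) (h \<circ> g)"
    using h g by (auto simp: proper_coloring_def dest: bij_betwE)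
  then show ?thesis
    unfolding chromatic_number_def by (auto intro: Least_le)
qed

section \<open>Classification by non-neighbours in a maximum clique\<close>

text \<open>Since there are no loops, a vertex \<open>a\<close> of a clique \<open>A\<close> misses
  exactly itself, so vertices inside and outside \<open>A\<close> are treated alike.\<close>

definition missed :: "'a set \<Rightarrow> 'a \<Rightarrow> 'a set" where
  "missed A x = {a \<in> A. (x, a) \<notin> parcs G}"

text \<open>Otherwise \<open>x\<close> would extend the maximum clique \<open>A\<close>.\<close>

lemma missed_nonempty:
  assumes A: "clique G A" "card A = clique_number G" and x: "x \<in> pverts G"
  shows "missed A x \<noteq> {}"
proof
  assume "missed A x = {}"
  then have adj: "\<And>a. a \<in> A \<Longrightarrow> (x, a) \<in> parcs G \<and> (a, x) \<in> parcs G"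
    using parcs_sym by (auto simp: missed_def)
  then have "x \<notin> A"
    using parcs_irrefl by blast
  moreover have "clique G (insert x A)"
    using A(1) x adj by (auto simp: clique_def)
  ultimately show False
    using clique_card_le[of "insert x A"] clique_finite[OF A(1)] A(2) by simp
qed

text \<open>If \<open>u\<close> and \<open>v\<close> were adjacent, exchanging \<open>a\<close> for
  both of them would give a larger clique.\<close>

lemma missed_single_indep:
  assumes A: "clique G A" "card A = clique_number G" and a: "a \<in> A"
    and u: "missed A u = {a}" and v: "missed A v = {a}"
  shows "(u, v) \<notin> parcs G"
proof
  assume uv: "(u, v) \<in> parcs G"
  have adj: "(u, b) \<in> parcs G" "(b, u) \<in> parcs G" "(v, b) \<in> parcs G" "(b, v) \<in> parcs G"
    if "b \<in> A - {a}" for b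
    using u v that parcs_sym by (auto simp: missed_def)
  have "u \<notin> A - {a}" "v \<notin> A - {a}" "u \<noteq> v"
    using adj parcs_irrefl uv by metis+
  moreover have "clique G (insert u (insert v (A - {a})))"
    using A(1) adj uv parcs_sym[OF uv] wellformed'[OF uv] by (auto simp: clique_def)
  moreover have "card A > 0"
    using a clique_finite[OF A(1)] by (auto simp: card_gt_0_iff)
  ultimately show False
    using clique_card_le[of "insert u (insert v (A - {a}))"] clique_finite[OF A(1)] A(2) a by simp
qed

text \<open>A clique containing \<open>a\<close> and \<open>b\<close> whose size is not 2 has a
  third vertex, so the edge \<open>a b\<close> lies in a triangle. This is where clique number 2 is
  excluded.\<close>

lemma missed_pair_indep:
  assumes con: "connected G" and bf: "induced_free butterfly G" and hf: "induced_free hammer G"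
    and A: "clique G A" "card A \<noteq> 2" and ab: "a \<in> A" "b \<in> A" "a \<noteq> b"
    and u: "{a, b} \<subseteq> missed A u" and v: "{a, b} \<subseteq> missed A v"
  shows "(u, v) \<notin> parcs G"
proof -
  have "A \<noteq> {a, b}"
    using A(2) ab by auto
  then obtain c where "c \<in> A" "c \<noteq> a" "c \<noteq> b"
    using ab by blast
  then have T: "(a, b) \<in> parcs G" "(b, c) \<in> parcs G" "(a, c) \<in> parcs G"
    using A(1) ab by (auto simp: clique_def)
  show ?thesis
    by (rule triangle_edge_anti_neighbours[OF con bf hf T]) (use u v in \<open>simp_all add: missed_def\<close>)
qed

text \<open>The singleton classes may be enlarged by sets \<open>R a\<close>, which the second bound uses to absorb the
  vertices covered by no pair inside \<open>B\<close>.\<close>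

lemma chromatic_number_le_singles_pairs:
  assumes con: "connected G" and bf: "induced_free butterfly G" and hf: "induced_free hammer G"
    and A: "clique G A" "card A = clique_number G" "card A \<noteq> 2" and B: "B \<subseteq> A"
    and single: "\<And>a u v. a \<in> A \<Longrightarrow> u \<in> {x. missed A x = {a}} \<union> R a \<Longrightarrow>
        v \<in> {x. missed A x = {a}} \<union> R a \<Longrightarrow> (u, v) \<notin> parcs G"
    and rest: "\<And>x. x \<in> pverts G \<Longrightarrow> card (missed A x) \<ge> 2 \<Longrightarrow> card (B \<inter> missed A x) \<le> 1 \<Longrightarrow>
        \<exists>a \<in> A. x \<in> R a"
  shows "chromatic_number G \<le> clique_number G + (card B choose 2)"
proof -
  let ?P = "{e. e \<subseteq> B \<and> card e = 2}"
  let ?S = "case_sum (\<lambda>a. {x. missed A x = {a}} \<union> R a) (\<lambda>e. {x. e \<subseteq> missed A x})"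
  have finA: "finite A" and finB: "finite B"
    using clique_finite[OF A(1)] finite_subset[OF B] by simp_all
  \<comment> \<open>One colour for each vertex of \<open>A\<close> and one for each 2-subset of
    \<open>B\<close>; the disjoint sum adds the two counts.\<close>
  have "chromatic_number G \<le> card (A <+> ?P)"
  proof (rule chromatic_number_le_cover[where S = ?S])
    show "finite (A <+> ?P)"
      using finA finB by auto
    show "pverts G \<subseteq> (\<Union>i \<in> A <+> ?P. ?S i)"
    proof
      fix x assume x: "x \<in> pverts G"
      have fin: "finite (missed A x)" and sub: "missed A x \<subseteq> A"
        using finA by (auto simp: missed_def)
      have pos: "card (missed A x) > 0"
        using missed_nonempty[OF A(1,2) x] fin by (simp add: card_gt_0_iff)
      consider "card (missed A x) = 1" | "card (B \<inter> missed A x) \<ge> 2"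
        | "card (missed A x) \<ge> 2" "card (B \<inter> missed A x) \<le> 1"
        using pos by linarith
      then show "x \<in> (\<Union>i \<in> A <+> ?P. ?S i)"
      proof cases
        case 1
        then obtain a where "missed A x = {a}"
          by (auto simp: card_1_singleton_iff)
        then show ?thesis
          using sub by (intro UN_I[of "Inl a"]) auto
      next
        case 2
        then obtain e where "e \<subseteq> B \<inter> missed A x" "card e = 2"
          by (meson obtain_subset_with_card_n)
        then show ?thesis
          by (intro UN_I[of "Inr e"]) auto
      next
        case 3
        then obtain a where "a \<in> A" "x \<in> R a"
          using rest[OF x] by blast
        then show ?thesis
          by (intro UN_I[of "Inl a"]) auto
      qed
    qed
    show "(u, v) \<notin> parcs G" if i: "i \<in> A <+> ?P" and u: "u \<in> ?S i" and v: "v \<in> ?S i" for i u v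
    proof (cases i)
      case (Inl a)
      then show ?thesis
        using single[of a u v] i u v by auto
    next
      case (Inr e)
      then obtain a b where e: "e = {a, b}" "a \<noteq> b" "e \<subseteq> B"
        using i by (auto simp: card_2_iff)
      show ?thesis
        by (rule missed_pair_indep[OF con bf hf A(1,3), of a b]) (use B Inr e u v in auto)
    qed
  qed
  also have "card (A <+> ?P) = clique_number G + (card B choose 2)"
    using finA finB A(2) by (simp add: card_Plus n_subsets)
  finally show ?thesis .
qed

text \<open>With \<open>B = A\<close>, each vertex missing at least two vertices of \<open>A\<close>
  is covered by a pair, so every \<open>R a\<close> can be empty.\<close>

lemma chromatic_number_le_Wagon:
  assumes con: "connected G" and bf: "induced_free butterfly G" and hf: "induced_free hammer G"
    and \<omega>: "clique_number G \<noteq> 2"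
  shows "chromatic_number G \<le> clique_number G + (clique_number G choose 2)"
proof -
  obtain A where A: "clique G A" "card A = clique_number G"
    by (rule obtain_max_clique)
  have "A \<inter> missed A x = missed A x" for x
    by (auto simp: missed_def)
  then show ?thesis
    using chromatic_number_le_singles_pairs[OF con bf hf A, of A "\<lambda>_. {}"]
      missed_single_indep[OF A] A(2) \<omega> by simp
qed

section \<open>The bound for large clique number\<close>

text \<open>Two missed vertices of \<open>A\<close>, together with \<open>p\<close> neighbours of
  \<open>x\<close> in \<open>A\<close>, would form the forbidden join with \<open>x\<close> as
  \<open>K_1\<close>.\<close>

lemma card_neighbours_in_max_clique:
  assumes free: "induced_free
      (graph_join (disjoint_union (complete_graph 1) (complete_graph 2)) (complete_graph p)) G"
    and A: "clique G A" and x: "x \<in> pverts G" and two: "card (missed A x) \<ge> 2"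
  shows "card (A - missed A x) < p"
proof (rule ccontr)
  assume "\<not> card (A - missed A x) < p"
  then obtain K where K: "K \<subseteq> A - missed A x" "card K = p"
    by (meson not_less obtain_subset_with_card_n)
  obtain e where e: "e \<subseteq> missed A x" "card e = 2"
    using two by (meson obtain_subset_with_card_n)
  obtain s t where st: "e = {s, t}" "s \<noteq> t"
    using e by (auto simp: card_2_iff)
  show False
  proof (rule join_freeD[OF free _ K(2) _ x])
    show "clique G K"
      using A K by (auto simp: clique_def)
    then show "finite K"
      by (rule clique_finite)
    show "(s, t) \<in> parcs G" "(x, s) \<notin> parcs G" "(x, t) \<notin> parcs G"
      using A e st by (auto simp: clique_def missed_def)
    show "(x, k) \<in> parcs G \<and> (s, k) \<in> parcs G \<and> (t, k) \<in> parcs G" if k: "k \<in> K" for k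
    proof -
      have "k \<in> A" "(x, k) \<in> parcs G" "s \<noteq> k" "t \<noteq> k" "s \<in> A" "t \<in> A"
        using k K e st by (auto simp: missed_def)
      then show ?thesis
        using A by (auto simp: clique_def)
    qed
  qed
qed

lemma chromatic_number_le_large_clique:
  assumes con: "connected G" and bf: "induced_free butterfly G" and hf: "induced_free hammer G"
    and free: "induced_free
      (graph_join (disjoint_union (complete_graph 1) (complete_graph 2)) (complete_graph p)) G"
    and \<omega>2: "clique_number G \<noteq> 2" and \<omega>: "clique_number G \<ge> p + 2"
  shows "chromatic_number G \<le> clique_number G + (p choose 2)"
proof -
  obtain A where A: "clique G A" "card A = clique_number G"
    by (rule obtain_max_clique)
  have finA: "finite A"
    using A(1) by (rule clique_finite)
  obtain B where B: "B \<subseteq> A" "card B = p"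
    using \<omega> A(2) by (metis add_leD1 obtain_subset_with_card_n)
  have finB: "finite B"
    using B(1) finA by (rule finite_subset)
  \<comment> \<open>Two vertices are wanted outside \<open>B\<close>: \<open>z\<close> lends its
    colour to the leftover set \<open>R\<close>, and the pair \<open>z\<close>, \<open>z'\<close>
    witnesses that \<open>R\<close> is independent.\<close>
  have "card (A - B) \<ge> 2"
    using \<omega> A(2) B finB by (simp add: card_Diff_subset)
  then obtain e where "e \<subseteq> A - B" "card e = 2"
    by (meson obtain_subset_with_card_n)
  then obtain z z' where z: "z \<in> A - B" "z' \<in> A - B" "z \<noteq> z'"
    by (auto simp: card_2_iff)
  define R where "R = {x \<in> pverts G. card (missed A x) \<ge> 2 \<and> card (B \<inter> missed A x) \<le> 1}"
  \<comment> \<open>Missing at most one vertex of \<open>B\<close> leaves at least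
    \<open>p - 1\<close> neighbours there, while \<open>A\<close> contains fewer than
    \<open>p\<close>. So equality holds and all neighbours in \<open>A\<close> lie in
    \<open>B\<close>; for \<open>p = 0\<close> there is no such \<open>x\<close>.\<close>
  have R: "A - B \<subseteq> missed A x \<and> (\<exists>b. B \<inter> missed A x = {b}) \<and> card (A - missed A x) = p - 1 \<and> p \<ge> 1"
    if x: "x \<in> R" for x
  proof -
    have lt: "card (A - missed A x) < p"
      using card_neighbours_in_max_clique[OF free A(1)] x by (simp add: R_def)
    have split: "card (B - missed A x) + card (B \<inter> missed A x) = p"
      using card_Diff_subset_Int[of B "missed A x"] finB B(2) card_mono[of B "B \<inter> missed A x"]
      by auto
    have sub: "B - missed A x \<subseteq> A - missed A x"
      using B(1) by blast
    then have le: "card (B - missed A x) \<le> card (A - missed A x)"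
      using finA by (intro card_mono) auto
    have c: "card (B \<inter> missed A x) \<le> 1"
      using x by (simp add: R_def)
    have c1: "card (B \<inter> missed A x) = 1" and eq: "card (B - missed A x) = card (A - missed A x)"
      using lt split le c by linarith+
    have "B - missed A x = A - missed A x"
      using card_subset_eq[OF _ sub eq] finA by auto
    moreover have "\<exists>b. B \<inter> missed A x = {b}"
      using c1 by (auto simp: card_1_singleton_iff)
    ultimately show ?thesis
      using lt c1 eq split by auto
  qed
  have RR: "(u, v) \<notin> parcs G" if "u \<in> R" "v \<in> R" for u v
  proof (rule missed_pair_indep[OF con bf hf A(1), of z z'])
    have "A - B \<subseteq> missed A u" "A - B \<subseteq> missed A v"
      using R[OF that(1)] R[OF that(2)] by simp_all
    then show "{z, z'} \<subseteq> missed A u" "{z, z'} \<subseteq> missed A v"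
      using z by auto
  qed (use A(2) \<omega>2 z in auto)
  \<comment> \<open>If \<open>r\<close> and \<open>w\<close> were adjacent, \<open>w\<close> would
    complete the \<open>p - 1\<close> neighbours of \<open>r\<close> in \<open>A\<close> to a
    \<open>K_p\<close>. It is joined to \<open>r\<close> and to the edge \<open>z' b\<close>, both
    of whose ends \<open>r\<close> misses: the forbidden join.\<close>
  have Rz: "(r, w) \<notin> parcs G" if r: "r \<in> R" and w: "missed A w = {z}" for r w
  proof
    assume rw: "(r, w) \<in> parcs G"
    obtain b where b: "B \<inter> missed A r = {b}"
      using R[OF r] by blast
    have wadj: "(w, k) \<in> parcs G" "(k, w) \<in> parcs G" if "k \<in> A" "k \<noteq> z" for k
      using w that parcs_sym by (auto simp: missed_def)
    have zr: "z \<in> missed A r" "z' \<in> missed A r"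
      using R[OF r] z by auto
    \<comment> \<open>Ensures that adding \<open>w\<close> raises the size from \<open>p - 1\<close>
      to \<open>p\<close>.\<close>
    have "w \<notin> A"
    proof
      assume "w \<in> A"
      then have "w = z"
        using wadj(1)[of w] parcs_irrefl by blast
      then show False
        using rw zr(1) by (simp add: missed_def)
    qed
    let ?K = "insert w (A - missed A r)"
    have bz: "b \<in> A" "b \<noteq> z" "b \<noteq> z'" "b \<in> missed A r"
      using b z B(1) by auto
    show False
    proof (rule join_freeD[OF free, of ?K r z' b])
      show K: "clique G ?K"
        using A(1) wadj zr wellformed'[OF rw] by (auto simp: clique_def)
      then show "finite ?K"
        by (rule clique_finite)
      show "card ?K = p"
        using R[OF r] finA \<open>w \<notin> A\<close> by simp
      show "r \<in> pverts G"
        using r by (simp add: R_def)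
      show "(z', b) \<in> parcs G"
        using A(1) bz z by (auto simp: clique_def)
      show "(r, z') \<notin> parcs G" "(r, b) \<notin> parcs G"
        using zr bz by (auto simp: missed_def)
      show "(r, k) \<in> parcs G \<and> (z', k) \<in> parcs G \<and> (b, k) \<in> parcs G" if k: "k \<in> ?K" for k
      proof (cases "k = w")
        case True
        then show ?thesis
          using rw wadj[of z'] wadj[of b] z bz by auto
      next
        case False
        then have "k \<in> A" "(r, k) \<in> parcs G" "k \<noteq> z'" "k \<noteq> b"
          using k zr bz by (auto simp: missed_def)
        then show ?thesis
          using A(1) bz z by (auto simp: clique_def)
      qed
    qed
  qed
  have zR: "(w, r) \<notin> parcs G" if "r \<in> R" "missed A w = {z}" for r w
    using Rz[OF that] parcs_sym by blast
  have "chromatic_number G \<le> clique_number G + (card B choose 2)"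
  proof (rule chromatic_number_le_singles_pairs[OF con bf hf A _ B(1),
        where R = "\<lambda>a. if a = z then R else {}"])
    show "card A \<noteq> 2"
      using A(2) \<omega>2 by simp
    show "(u, v) \<notin> parcs G" if "a \<in> A" "u \<in> {x. missed A x = {a}} \<union> (if a = z then R else {})"
      "v \<in> {x. missed A x = {a}} \<union> (if a = z then R else {})" for a u v
      using that missed_single_indep[OF A] RR Rz zR by (auto split: if_splits)
    show "\<exists>a \<in> A. x \<in> (if a = z then R else {})"
      if "x \<in> pverts G" "card (missed A x) \<ge> 2" "card (B \<inter> missed A x) \<le> 1" for x
      using that z by (intro bexI[of _ z]) (auto simp: R_def)
  qed
  then show ?thesis
    using B(2) by simp
qed

end

theorem theorem3p19:
  fixes p :: nat and G :: "'a pair_pre_digraph"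
  assumes "pair_graph G" and "connected G"
    and "induced_free butterfly G"
    and "induced_free hammer G"
    and "induced_free (graph_join (disjoint_union (complete_graph 1) (complete_graph 2)) (complete_graph p)) G"
    and "clique_number G \<noteq> 2"
  shows "(1 \<le> clique_number G \<and> clique_number G \<le> p + 1 \<longrightarrow>
           real (chromatic_number G) \<le> real (clique_number G) + real p * (real p + 1) / 2)
       \<and> (clique_number G \<ge> p + 2 \<longrightarrow>
           real (chromatic_number G) \<le> real (clique_number G) + real p * (real p - 1) / 2)"
proof -
  interpret pair_graph G by fact
  \<comment> \<open>At \<open>n = 0\<close> the real factor \<open>n - 1\<close> is negative, but
    the product is still 0.\<close>
  have choose_real: "real (n choose 2) = real n * (real n - 1) / 2" for n
    by (cases n) (auto simp: choose_two real_of_nat_div algebra_simps)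
  have "real (chromatic_number G) \<le> real (clique_number G) + real p * (real p + 1) / 2"
    if "clique_number G \<le> p + 1"
  proof -
    have "chromatic_number G \<le> clique_number G + (clique_number G choose 2)"
      using assms(2-4,6) by (rule chromatic_number_le_Wagon)
    \<comment> \<open>The required extra term is \<open>p + 1 choose 2\<close>, so monotonicity of
      the binomial suffices.\<close>
    also have "\<dots> \<le> clique_number G + (p + 1 choose 2)"
      using that by (intro add_left_mono binomial_right_mono)
    finally have "real (chromatic_number G) \<le> real (clique_number G) + real (p + 1 choose 2)"
      by linarith
    then show ?thesis
      unfolding choose_real by (simp add: algebra_simps)
  qed
  moreover have "real (chromatic_number G) \<le> real (clique_number G) + real p * (real p - 1) / 2"
    if "clique_number G \<ge> p + 2"
  proof -
    have "chromatic_number G \<le> clique_number G + (p choose 2)"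
      using assms(2-6) that by (rule chromatic_number_le_large_clique)
    then have "real (chromatic_number G) \<le> real (clique_number G) + real (p choose 2)"
      by linarith
    then show ?thesis
      unfolding choose_real .
  qed
  ultimately show ?thesis
    by blast
qed

end
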